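(* Let $T>0$ and let $v\in C^2(Q_T)$ be such that: (i) there exists $\lambda\in C^1(Q_T)$ such that $\lambda_t\ge 0$ and $0\le\lambda\le1$ in $Q_T$, where $v\ge A$ in $Q_T$ and $\lambda=1$ at every point at which $v>B$; (ii) $u:=(1-\lambda)\beta_0(v)+\lambda\beta_2(v)$ satisfies $u_t=v_{xx}$ in $Q_T$. Then $v$ satisfies the entropy inequality: for every $g\in C^1(\mathbb{R})$ with $g'\ge0$ and every $\psi\in C_0^\infty(Q_T)$ with $\psi\ge0$, $$\iint_{Q_T}\Big\{G^*\psi_t-g(v)\,v_x\psi_x-g'(v)|v_x|^2\psi\Big\}\,dx\,dt\ \ge\ 0,$$ where $$G(u):=\int_0^u g(\phi(s))\,ds+K\quad(K\in\mathbb{R}),\qquad G^*(x,t):=(1-\lambda(x,t))\,G(\beta_0(v(x,t)))+\lambda(x,t)\,G(\beta_2(v(x,t))).$$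
   Context: Let $L>0$ and $Q_T=(0,L)\times(0,T)$. Let $b<c$ be real numbers, $\alpha_1,\alpha_2>0$, $\gamma_1,\gamma_2\in\mathbb{R}$, $\phi_i(u)=\alpha_i u+\gamma_i$ for $i=1,2$, and suppose $A:=\phi_2(c)<B:=\phi_1(b)$. Let $\phi_0(u)=\frac{A(u-b)-B(u-c)}{c-b}$. The continuous, piecewise linear, nonmonotone function $\phi:\mathbb{R}\to\mathbb{R}$ is $\phi=\phi_1$ on $(-\infty,b]$, $\phi=\phi_0$ on $(b,c)$, $\phi=\phi_2$ on $[c,\infty)$. Let $\beta_0$ and $\beta_2$ be the inverse functions of the branches $\phi_0$ and $\phi_2$, defined on $(A,B)$ and $(A,\infty)$ respectively and extended continuously to the finite endpoints. Where $\lambda=1$, the terms $(1-\lambda)\beta_0(v)$ and $(1-\lambda)G(\beta_0(v))$ are understood to be $0$ (also if $v>B$). *)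

theory Defs
  imports "HOL-Analysis.Analysis"
begin

text \<open>Functions of \<open>(x, t)\<close> are total functions on \<open>real \<times> real\<close>; on an open set \<open>S\<close> the notions below
  depend only on their values in \<open>S\<close>.\<close>

definition Dx :: "(real \<times> real \<Rightarrow> real) \<Rightarrow> real \<times> real \<Rightarrow> real" where
  "Dx f = (\<lambda>(x, t). deriv (\<lambda>y. f (y, t)) x)"

definition Dt :: "(real \<times> real \<Rightarrow> real) \<Rightarrow> real \<times> real \<Rightarrow> real" where
  "Dt f = (\<lambda>(x, t). deriv (\<lambda>s. f (x, s)) t)"

fun Ck_on :: "nat \<Rightarrow> (real \<times> real \<Rightarrow> real) \<Rightarrow> (real \<times> real) set \<Rightarrow> bool" where
  "Ck_on 0 f S \<longleftrightarrow> continuous_on S f"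
| "Ck_on (Suc k) f S \<longleftrightarrow> continuous_on S f \<and>
     (\<forall>(x, t) \<in> S. (\<lambda>y. f (y, t)) field_differentiable (at x) \<and>
                  (\<lambda>s. f (x, s)) field_differentiable (at t)) \<and>
     Ck_on k (Dx f) S \<and> Ck_on k (Dt f) S"

text \<open>Elements of \<open>C\<^sub>0\<^sup>\<infinity>(S)\<close>, identified with their extensions by zero.\<close>

definition test_function_on :: "(real \<times> real) set \<Rightarrow> (real \<times> real \<Rightarrow> real) \<Rightarrow> bool" where
  "test_function_on S \<psi> \<longleftrightarrow>
     (\<forall>k. Ck_on k \<psi> UNIV) \<and> compact (closure {p. \<psi> p \<noteq> 0}) \<and> closure {p. \<psi> p \<noteq> 0} \<subseteq> S"

definition phi_outer :: "real \<Rightarrow> real \<Rightarrow> real \<Rightarrow> real" where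
  "phi_outer \<alpha> \<gamma> u = \<alpha> * u + \<gamma>"

definition phi_mid :: "real \<Rightarrow> real \<Rightarrow> real \<Rightarrow> real \<Rightarrow> real \<Rightarrow> real" where
  "phi_mid b c A B u = (A * (u - b) - B * (u - c)) / (c - b)"

definition phi :: "real \<Rightarrow> real \<Rightarrow> real \<Rightarrow> real \<Rightarrow> real \<Rightarrow> real \<Rightarrow> real \<Rightarrow> real" where
  "phi b c \<alpha>1 \<gamma>1 \<alpha>2 \<gamma>2 u =
     (if u \<le> b then phi_outer \<alpha>1 \<gamma>1 u
      else if u < c then phi_mid b c (phi_outer \<alpha>2 \<gamma>2 c) (phi_outer \<alpha>1 \<gamma>1 b) u
      else phi_outer \<alpha>2 \<gamma>2 u)"

text \<open>The branches are inverted on closed intervals, which includes the continuous extension to the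
  finite endpoints (see the lemmas below). Outside \<open>{A..B}\<close>, respectively \<open>{A..}\<close>, the values are
  unspecified.\<close>

definition beta0 :: "real \<Rightarrow> real \<Rightarrow> real \<Rightarrow> real \<Rightarrow> real \<Rightarrow> real" where
  "beta0 b c A B = the_inv_into {b..c} (phi_mid b c A B)"

definition beta2 :: "real \<Rightarrow> real \<Rightarrow> real \<Rightarrow> real \<Rightarrow> real" where
  "beta2 c \<alpha>2 \<gamma>2 = the_inv_into {c..} (phi_outer \<alpha>2 \<gamma>2)"

text \<open>A term with factor \<open>1 - l = 0\<close> vanishes whatever the (possibly unspecified) value of \<open>y0\<close> is.\<close>

definition mix :: "real \<Rightarrow> real \<Rightarrow> real \<Rightarrow> real" where
  "mix l y0 y2 = (1 - l) * y0 + l * y2"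

text \<open>\<open>f\<close> plays the role of \<open>\<phi>\<close>; the interval integral is signed, so \<open>u < 0\<close> is covered.\<close>

definition entropy_G :: "(real \<Rightarrow> real) \<Rightarrow> (real \<Rightarrow> real) \<Rightarrow> real \<Rightarrow> real \<Rightarrow> real" where
  "entropy_G f g K u = (LBINT s=ereal 0..ereal u. g (f s)) + K"

lemma beta0_eq:
  assumes "b < c" "A < B" "w \<in> {A..B}"
  shows "beta0 b c A B w = b + (B - w) * (c - b) / (B - A)"
  unfolding beta0_def
proof (rule the_inv_into_f_eq)
  have "phi_mid b c A B u = B - (B - A) * (u - b) / (c - b)" for u
    using assms by (simp add: phi_mid_def field_simps)
  note eq = this
  show "inj_on (phi_mid b c A B) {b..c}"
    using assms by (auto simp: inj_on_def eq)
  show "phi_mid b c A B (b + (B - w) * (c - b) / (B - A)) = w"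
    using assms by (simp add: eq)
  have "(B - w) * (c - b) \<le> (B - A) * (c - b)"
    using assms by (intro mult_right_mono) auto
  then have "(B - w) * (c - b) / (B - A) \<le> c - b"
    using assms by (simp add: divide_le_eq mult.commute)
  then show "b + (B - w) * (c - b) / (B - A) \<in> {b..c}"
    using assms by simp
qed

lemma continuous_on_beta0:
  assumes "b < c" "A < B"
  shows "continuous_on {A..B} (beta0 b c A B)"
proof -
  have "continuous_on {A..B} (\<lambda>w. b + (B - w) * (c - b) / (B - A))"
    using assms by (intro continuous_intros) auto
  then show ?thesis
    by (rule continuous_on_eq) (simp add: beta0_eq[OF assms])
qed

lemma beta2_eq:
  assumes "0 < \<alpha>2" "phi_outer \<alpha>2 \<gamma>2 c \<le> w"
  shows "beta2 c \<alpha>2 \<gamma>2 w = (w - \<gamma>2) / \<alpha>2"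
  unfolding beta2_def
  using assms by (intro the_inv_into_f_eq) (auto simp: phi_outer_def inj_on_def field_simps)

lemma continuous_on_beta2:
  assumes "0 < \<alpha>2"
  shows "continuous_on {phi_outer \<alpha>2 \<gamma>2 c..} (beta2 c \<alpha>2 \<gamma>2)"
proof -
  have "continuous_on {phi_outer \<alpha>2 \<gamma>2 c..} (\<lambda>w. (w - \<gamma>2) / \<alpha>2)"
    using assms by (intro continuous_intros) auto
  then show ?thesis
    by (rule continuous_on_eq) (simp add: beta2_eq[OF assms])
qed

end

theory Submission imports Defs begin

text \<open>Where \<open>v > B\<close> the coefficient \<open>1 - \<lambda>\<close> vanishes, so \<open>\<beta>\<^sub>0\<close> may be replaced by its affine
  extension to the whole line; then \<open>u\<close> and \<open>G\<^sup>*\<close> have continuous \<open>t\<close>-derivatives in \<open>Q\<close>, and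
  \<open>G\<^sup>*\<^sub>t = g(v) u\<^sub>t + \<lambda>\<^sub>t (G(\<beta>\<^sub>2(v)) - G(\<beta>\<^sub>0(v)) - g(v) (\<beta>\<^sub>2(v) - \<beta>\<^sub>0(v)))\<close>.
  Between \<open>\<beta>\<^sub>0(v)\<close> and \<open>\<beta>\<^sub>2(v)\<close> one has \<open>\<phi> \<le> v\<close>, so the bracket is nonpositive and
  \<open>G\<^sup>*\<^sub>t \<le> g(v) v\<^sub>x\<^sub>x\<close>. The integrand equals
  \<open>(G\<^sup>* \<psi>)\<^sub>t - (g(v) v\<^sub>x \<psi>)\<^sub>x + \<psi> (g(v) v\<^sub>x\<^sub>x - G\<^sup>*\<^sub>t)\<close>, whose first two terms integrate to zero.\<close>

section \<open>Integrals of derivatives with compact support\<close>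

text \<open>\<open>S - C\<close> is open, so \<open>f\<close> vanishes near the point. This
  transfers the support condition from a function to its partial derivatives along slices.\<close>

lemma DERIV_eq_0_outside_support:
  fixes f :: "real \<Rightarrow> real"
  assumes "open S" "closed C" "\<And>x. x \<in> S - C \<Longrightarrow> f x = 0"
    and "(f has_real_derivative d) (at x)" "x \<in> S - C"
  shows "d = 0"
proof -
  have "open (S - C)" using assms(1,2) by (rule open_Diff)
  then have "(f has_real_derivative 0) (at x)"
    by (rule has_field_derivative_transform_within_open[OF DERIV_const])
      (use assms(3,5) in auto)
  with assms(4) show ?thesis by (rule DERIV_unique)
qed

text \<open>The open sets \<open>S\<close> and \<open>- C\<close> cover the line, so the extension
  of \<open>f\<close> by zero is continuously differentiable everywhere. The fundamental theorem on
  one large interval then suffices, whatever the shape of the open set \<open>S\<close>.\<close>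

lemma integral_compact_support_derivative_eq_0:
  fixes f f' :: "real \<Rightarrow> real"
  assumes S: "open S" and C: "compact C" "C \<subseteq> S"
    and f0: "\<And>x. x \<in> S - C \<Longrightarrow> f x = 0"
    and f': "\<And>x. x \<in> S \<Longrightarrow> (f has_real_derivative f' x) (at x)"
    and cont: "continuous_on S f'"
  shows "(LBINT x. indicator S x * f' x) = 0"
proof -
  define F where "F = (\<lambda>x. if x \<in> S then f x else 0)"
  define F' where "F' = (\<lambda>x. indicator S x * f' x)"
  have opn: "open (- C)" using C(1) compact_imp_closed by blast
  have F0: "F x = 0" if "x \<notin> C" for x using that f0 by (auto simp: F_def)
  have f'0: "f' x = 0" if "x \<in> S - C" for x
    using DERIV_eq_0_outside_support[OF S compact_imp_closed[OF C(1)] f0 f' that] that by auto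
  have F'0: "F' x = 0" if "x \<notin> C" for x
    using that f'0 by (auto simp: F'_def indicator_def)
  have der: "(F has_real_derivative F' x) (at x)" for x
  proof (cases "x \<in> S")
    case True
    have "(F has_real_derivative f' x) (at x)"
      by (rule has_field_derivative_transform_within_open[OF f'[OF True] S True]) (simp add: F_def)
    then show ?thesis using True by (simp add: F'_def)
  next
    case False
    then have x: "x \<in> - C" using C(2) by auto
    have "(F has_real_derivative 0) (at x)"
      by (rule has_field_derivative_transform_within_open[OF DERIV_const opn x]) (simp add: F0)
    then show ?thesis using x by (simp add: F'0)
  qed
  have "continuous_on (S \<union> - C) F'"
  proof (rule continuous_on_open_Un[OF S opn])
    show "continuous_on S F'"
      by (rule continuous_on_eq[OF cont]) (simp add: F'_def)
    show "continuous_on (- C) F'"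
      by (rule continuous_on_eq[OF continuous_on_const[of _ 0]]) (simp add: F'0)
  qed
  moreover have "S \<union> - C = UNIV" using C(2) by auto
  ultimately have contF': "continuous_on UNIV F'" by simp
  obtain R where R: "\<And>x. x \<in> C \<Longrightarrow> \<bar>x\<bar> \<le> R" "R > 0"
    using compact_imp_bounded[OF C(1)] unfolding bounded_pos by auto
  \<comment> \<open>\<open>R\<close> itself may belong to \<open>C\<close>; the margin 1 puts both
    endpoints outside \<open>C\<close>, where \<open>F\<close> vanishes.\<close>
  have "has_bochner_integral lborel (\<lambda>x. indicator {-R-1..R+1} x *\<^sub>R F' x) (F (R+1) - F (-R-1))"
  proof (rule has_bochner_integral_FTC_Icc)
    show "(F has_vector_derivative F' x) (at x within {-R-1..R+1})" for x
      using der[of x] by (simp add: has_real_derivative_iff_has_vector_derivative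
          has_vector_derivative_at_within)
    show "continuous_on {-R-1..R+1} F'" using contF' continuous_on_subset by blast
  qed (use R(2) in auto)
  moreover have "F (R+1) = 0" "F (-R-1) = 0" using R by (force intro!: F0)+
  moreover have "(\<lambda>x. indicator {-R-1..R+1} x *\<^sub>R F' x) = F'"
  proof
    fix x show "indicator {-R-1..R+1} x *\<^sub>R F' x = F' x"
      using F'0[of x] R(1)[of x] by (cases "x \<in> C") (auto simp: indicator_def)
  qed
  ultimately show ?thesis
    by (simp add: has_bochner_integral_iff F'_def)
qed

text \<open>A function continuous on \<open>S\<close> may be unbounded near the boundary of
  \<open>S\<close>, but this one lives on the compact set \<open>C\<close>.\<close>

lemma set_integrable_compact_support:
  fixes f :: "'a::euclidean_space \<Rightarrow> real"
  assumes "compact C" "C \<subseteq> S" "\<And>x. x \<in> S - C \<Longrightarrow> f x = 0" "continuous_on S f"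
  shows "set_integrable lborel S f"
proof -
  have "integrable lborel (\<lambda>x. indicator C x *\<^sub>R f x)"
    using assms by (intro borel_integrable_compact) (auto intro: continuous_on_subset)
  moreover have "(\<lambda>x. indicator C x *\<^sub>R f x) = (\<lambda>x. indicator S x *\<^sub>R f x)"
    using assms(2,3) by (auto simp: indicator_def fun_eq_iff)
  ultimately show ?thesis by (simp add: set_integrable_def)
qed

section \<open>Slices of plane sets and Fubini\<close>

lemma compact_slices:
  fixes C :: "(real \<times> real) set"
  assumes "compact C"
  shows "compact {t. (x, t) \<in> C}" "compact {x. (x, t) \<in> C}"
proof -
  have "{t. (x, t) \<in> C} = snd ` (C \<inter> ({x} \<times> UNIV))" "{x. (x, t) \<in> C} = fst ` (C \<inter> (UNIV \<times> {t}))"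
    by force+
  moreover have "compact (C \<inter> ({x} \<times> UNIV))" "compact (C \<inter> (UNIV \<times> {t}))"
    using assms by (auto intro!: compact_Int_closed closed_Times)
  ultimately show "compact {t. (x, t) \<in> C}" "compact {x. (x, t) \<in> C}"
    by (auto intro!: compact_continuous_image continuous_intros)
qed

lemma open_slices:
  fixes S :: "(real \<times> real) set"
  assumes "open S"
  shows "open {t. (x, t) \<in> S}" "open {x. (x, t) \<in> S}"
proof -
  have "continuous_on UNIV (\<lambda>t. (x, t))" "continuous_on UNIV (\<lambda>x. (x, t))"
    by (intro continuous_intros)+
  from this[THEN open_vimage[OF assms]] show "open {t. (x, t) \<in> S}" "open {x. (x, t) \<in> S}"
    by (simp_all add: vimage_def)
qed

text \<open>By Fubini the integral is iterated with \<open>t\<close> innermost; each slice integral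
  vanishes by the one-dimensional result.\<close>

lemma set_integral_t_derivative_eq_0:
  fixes h h' :: "real \<times> real \<Rightarrow> real"
  assumes S: "open S" and C: "compact C" "C \<subseteq> S"
    and h0: "\<And>p. p \<in> S - C \<Longrightarrow> h p = 0"
    and h': "\<And>x t. (x, t) \<in> S \<Longrightarrow> ((\<lambda>s. h (x, s)) has_real_derivative h' (x, t)) (at t)"
    and cont: "continuous_on S h'"
  shows "set_integrable lborel S h'" "set_lebesgue_integral lborel S h' = 0"
proof -
  have h'0: "h' p = 0" if "p \<in> S - C" for p
  proof (cases p)
    case (Pair x t)
    show ?thesis
      unfolding Pair
      by (rule DERIV_eq_0_outside_support[OF open_slices(1)[OF S, of x]
            compact_imp_closed[OF compact_slices(1)[OF C(1), of x]] _ h'])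
        (use that h0 Pair in auto)
  qed
  show int: "set_integrable lborel S h'"
    using set_integrable_compact_support[OF C h'0 cont] .
  have "set_lebesgue_integral lborel S h'
      = integral\<^sup>L (lborel \<Otimes>\<^sub>M lborel) (\<lambda>(x, t). indicator S (x, t) * h' (x, t))"
    by (simp add: set_lebesgue_integral_def lborel_prod case_prod_unfold)
  also have "\<dots> = (LBINT x. LBINT t. indicator S (x, t) * h' (x, t))"
    using int by (intro lborel_pair.integral_fst[symmetric])
      (simp add: set_integrable_def lborel_prod case_prod_unfold)
  also have "\<dots> = (LBINT x::real. 0)"
  proof (rule Bochner_Integration.integral_cong[OF refl])
    fix x
    have "(LBINT t. indicator {t. (x, t) \<in> S} t * h' (x, t)) = 0"
      by (rule integral_compact_support_derivative_eq_0[OF open_slices(1)[OF S, of x]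
            compact_slices(1)[OF C(1), of x], where f = "\<lambda>s. h (x, s)"])
        (use C(2) h0 h' in \<open>auto intro!: continuous_on_compose2[OF cont] continuous_intros\<close>)
    then show "(LBINT t. indicator S (x, t) * h' (x, t)) = 0"
      by (simp add: indicator_def)
  qed
  finally show "set_lebesgue_integral lborel S h' = 0" by simp
qed

lemma set_integral_x_derivative_eq_0:
  fixes h h' :: "real \<times> real \<Rightarrow> real"
  assumes S: "open S" and C: "compact C" "C \<subseteq> S"
    and h0: "\<And>p. p \<in> S - C \<Longrightarrow> h p = 0"
    and h': "\<And>x t. (x, t) \<in> S \<Longrightarrow> ((\<lambda>y. h (y, t)) has_real_derivative h' (x, t)) (at x)"
    and cont: "continuous_on S h'"
  shows "set_integrable lborel S h'" "set_lebesgue_integral lborel S h' = 0"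
proof -
  have h'0: "h' p = 0" if "p \<in> S - C" for p
  proof (cases p)
    case (Pair x t)
    show ?thesis
      unfolding Pair
      by (rule DERIV_eq_0_outside_support[OF open_slices(2)[OF S, of t]
            compact_imp_closed[OF compact_slices(2)[OF C(1), of t]] _ h'])
        (use that h0 Pair in auto)
  qed
  show int: "set_integrable lborel S h'"
    using set_integrable_compact_support[OF C h'0 cont] .
  have "set_lebesgue_integral lborel S h'
      = integral\<^sup>L (lborel \<Otimes>\<^sub>M lborel) (\<lambda>(x, t). indicator S (x, t) * h' (x, t))"
    by (simp add: set_lebesgue_integral_def lborel_prod case_prod_unfold)
  \<comment> \<open>The opposite order of integration puts the differentiated variable
    \<open>x\<close> innermost.\<close>
  also have "\<dots> = (LBINT t. LBINT x. indicator S (x, t) * h' (x, t))"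
    using int by (intro lborel_pair.integral_snd[symmetric])
      (simp add: set_integrable_def lborel_prod case_prod_unfold)
  also have "\<dots> = (LBINT t::real. 0)"
  proof (rule Bochner_Integration.integral_cong[OF refl])
    fix t
    have "(LBINT x. indicator {x. (x, t) \<in> S} x * h' (x, t)) = 0"
      by (rule integral_compact_support_derivative_eq_0[OF open_slices(2)[OF S, of t]
            compact_slices(2)[OF C(1), of t], where f = "\<lambda>y. h (y, t)"])
        (use C(2) h0 h' in \<open>auto intro!: continuous_on_compose2[OF cont] continuous_intros\<close>)
    then show "(LBINT x. indicator S (x, t) * h' (x, t)) = 0"
      by (simp add: indicator_def)
  qed
  finally show "set_lebesgue_integral lborel S h' = 0" by simp
qed

section \<open>Functions of class \<open>C\<^sup>k\<close>\<close>

lemma Ck_on_Suc_Dx_DERIV: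
  assumes "Ck_on (Suc k) f S" "(x, t) \<in> S"
  shows "((\<lambda>y. f (y, t)) has_real_derivative Dx f (x, t)) (at x)"
  using assms by (auto simp: Dx_def DERIV_deriv_iff_field_differentiable)

lemma Ck_on_Suc_Dt_DERIV:
  assumes "Ck_on (Suc k) f S" "(x, t) \<in> S"
  shows "((\<lambda>s. f (x, s)) has_real_derivative Dt f (x, t)) (at t)"
  using assms by (auto simp: Dt_def DERIV_deriv_iff_field_differentiable)

section \<open>The nonlinearity and the entropy\<close>

text \<open>Clamping the argument to each of the three intervals turns the case distinction into a
  sum of continuous functions; the pieces fit because \<open>phi_mid\<close> takes the values
  \<open>B\<close> at \<open>b\<close> and \<open>A\<close> at \<open>c\<close>.\<close>

lemma continuous_on_phi:
  assumes "b < c"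
  shows "continuous_on UNIV (phi b c \<alpha>1 \<gamma>1 \<alpha>2 \<gamma>2)"
proof -
  define A B where AB: "A = phi_outer \<alpha>2 \<gamma>2 c" "B = phi_outer \<alpha>1 \<gamma>1 b"
  have "phi b c \<alpha>1 \<gamma>1 \<alpha>2 \<gamma>2 = (\<lambda>u. \<alpha>1 * (min u b - b) +
      phi_mid b c A B (max b (min u c)) + \<alpha>2 * (max u c - c))"
    using assms by (auto simp: fun_eq_iff phi_def AB phi_outer_def phi_mid_def field_simps)
  moreover have "continuous_on UNIV \<dots>"
    unfolding phi_mid_def using assms by (intro continuous_intros) auto
  ultimately show ?thesis by simp
qed

lemma entropy_G_DERIV:
  assumes "continuous_on UNIV f" "continuous_on UNIV g"
  shows "(entropy_G f g K has_real_derivative g (f u)) (at u)"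
proof -
  \<comment> \<open>The interval from \<open>a\<close> to \<open>d\<close> contains the base point 0
    and has \<open>u\<close> in its interior, so the one-interval derivative is a full
    derivative.\<close>
  define a where "a = - \<bar>u\<bar> - 1"
  define d where "d = \<bar>u\<bar> + 1"
  have "continuous_on {a..d} (\<lambda>s. g (f s))"
    by (rule continuous_on_compose2[OF assms(2)])
       (use assms(1) in \<open>auto intro: continuous_on_subset\<close>)
  then have "((\<lambda>u. LBINT s=ereal 0..ereal u. g (f s)) has_vector_derivative g (f u)) (at u within {a..d})"
    by (intro interval_integral_FTC2) (auto simp: a_def d_def)
  moreover have "at u within {a..d} = at u"
    by (rule at_within_interior) (auto simp: a_def d_def)
  ultimately have "((\<lambda>u. LBINT s=ereal 0..ereal u. g (f s)) has_real_derivative g (f u)) (at u)"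
    by (simp add: has_real_derivative_iff_has_vector_derivative)
  from DERIV_add[OF this DERIV_const[of K]] show ?thesis
    by (simp add: entropy_G_def[abs_def])
qed

text \<open>The bounds on \<open>s\<close> are the explicit values of \<open>beta0\<close> and
  \<open>beta2\<close> at \<open>w\<close>. The middle branch decreases, so it is at most
  \<open>w\<close> to the right of the first; the last branch increases, so it is at most
  \<open>w\<close> to the left of the second.\<close>

lemma phi_le_between_branches:
  assumes "b < c" "0 < \<alpha>2" and AB: "A = phi_outer \<alpha>2 \<gamma>2 c" "B = phi_outer \<alpha>1 \<gamma>1 b" "A < B"
    and w: "A \<le> w" "w \<le> B"
    and s: "b + (B - w) * (c - b) / (B - A) \<le> s" "s \<le> (w - \<gamma>2) / \<alpha>2"
  shows "phi b c \<alpha>1 \<gamma>1 \<alpha>2 \<gamma>2 s \<le> w"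
proof -
  have mid: "phi_mid b c A B s \<le> w"
  proof -
    have "phi_mid b c A B s = B - (B - A) * (s - b) / (c - b)"
      using assms by (simp add: phi_mid_def field_simps)
    moreover have "(B - w) * (c - b) \<le> (B - A) * (s - b)"
      using s(1) \<open>A < B\<close> by (simp add: field_simps)
    then have "B - w \<le> (B - A) * (s - b) / (c - b)"
      using \<open>b < c\<close> by (simp add: pos_le_divide_eq)
    ultimately show ?thesis by simp
  qed
  have "b \<le> b + (B - w) * (c - b) / (B - A)" using assms by simp
  then have "b \<le> s" using s by simp
  moreover have "phi_outer \<alpha>2 \<gamma>2 s \<le> w"
    using s(2) \<open>0 < \<alpha>2\<close> by (simp add: phi_outer_def field_simps)
  \<comment> \<open>At \<open>b\<close> itself \<open>phi\<close> is defined by its first branch,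
    which agrees there with \<open>phi_mid\<close>.\<close>
  moreover have "phi_outer \<alpha>1 \<gamma>1 s \<le> w" if "s = b"
  proof -
    have "phi_mid b c A B s = B" using that \<open>b < c\<close> by (simp add: phi_mid_def field_simps)
    then show ?thesis using mid that AB(2) by simp
  qed
  ultimately show ?thesis
    using mid by (auto simp: phi_def AB)
qed

text \<open>The map \<open>entropy_G f g K s - g w * s\<close> has derivative
  \<open>g (f s) - g w\<close>, which is nonpositive on the interval by monotonicity of
  \<open>g\<close>. This gives the sign in the entropy inequality.\<close>

lemma entropy_G_increment_le:
  assumes f: "continuous_on UNIV f" and g: "continuous_on UNIV g" "mono g"
    and "p \<le> q" and le: "\<And>s. p \<le> s \<Longrightarrow> s \<le> q \<Longrightarrow> f s \<le> w"
  shows "entropy_G f g K q - entropy_G f g K p \<le> g w * (q - p)"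
proof -
  have "entropy_G f g K q - g w * q \<le> entropy_G f g K p - g w * p"
  proof (rule DERIV_nonpos_imp_nonincreasing[OF \<open>p \<le> q\<close>])
    fix s assume "p \<le> s" "s \<le> q"
    then have "g (f s) - g w \<le> 0" using le monoD[OF g(2)] by simp
    moreover have "((\<lambda>s. entropy_G f g K s - g w * s) has_real_derivative g (f s) - g w) (at s)"
      by (auto intro!: derivative_eq_intros entropy_G_DERIV f g)
    ultimately show "\<exists>y. ((\<lambda>s. entropy_G f g K s - g w * s) has_real_derivative y) (at s) \<and> y \<le> 0"
      by blast
  qed
  then show ?thesis by (simp add: algebra_simps)
qed

section \<open>The entropy inequality\<close>

theorem proposition2p5:
  fixes L T b c \<alpha>1 \<alpha>2 \<gamma>1 \<gamma>2 A B :: real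
    and Q :: "(real \<times> real) set"
    and v lam u :: "real \<times> real \<Rightarrow> real"
  assumes "L > 0" and "T > 0" and "b < c" and "\<alpha>1 > 0" and "\<alpha>2 > 0"
    and A: "A = phi_outer \<alpha>2 \<gamma>2 c" and B: "B = phi_outer \<alpha>1 \<gamma>1 b" and "A < B"
    and Q: "Q = {0<..<L} \<times> {0<..<T}"
    and v_C2: "Ck_on 2 v Q"
    and lam_C1: "Ck_on 1 lam Q"
    and lam_t: "\<forall>p\<in>Q. Dt lam p \<ge> 0"
    and lam_range: "\<forall>p\<in>Q. 0 \<le> lam p \<and> lam p \<le> 1"
    and v_ge: "\<forall>p\<in>Q. A \<le> v p"
    and lam_one: "\<forall>p\<in>Q. v p > B \<longrightarrow> lam p = 1"
    and u: "u = (\<lambda>p. mix (lam p) (beta0 b c A B (v p)) (beta2 c \<alpha>2 \<gamma>2 (v p)))"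
    and pde: "\<forall>(x, t)\<in>Q. ((\<lambda>s. u (x, s)) has_real_derivative Dx (Dx v) (x, t)) (at t)"
  shows "\<forall>g K \<psi>. g C1_differentiable_on UNIV \<longrightarrow> (\<forall>s. deriv g s \<ge> 0) \<longrightarrow>
           test_function_on Q \<psi> \<longrightarrow> (\<forall>p\<in>Q. \<psi> p \<ge> 0) \<longrightarrow>
           (let G = entropy_G (phi b c \<alpha>1 \<gamma>1 \<alpha>2 \<gamma>2) g K;
                Gstar = (\<lambda>p. mix (lam p) (G (beta0 b c A B (v p))) (G (beta2 c \<alpha>2 \<gamma>2 (v p))));
                F = (\<lambda>p. Gstar p * Dt \<psi> p - g (v p) * Dx v p * Dx \<psi> p
                           - deriv g (v p) * \<bar>Dx v p\<bar>\<^sup>2 * \<psi> p)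
            in set_integrable lborel Q F \<and> set_lebesgue_integral lborel Q F \<ge> 0)"
proof (intro allI impI)
  fix g :: "real \<Rightarrow> real" and K :: real and \<psi> :: "real \<times> real \<Rightarrow> real"
  assume g_C1: "g C1_differentiable_on UNIV" and g'_ge: "\<forall>s. deriv g s \<ge> 0"
    and \<psi>: "test_function_on Q \<psi>" and \<psi>_ge: "\<forall>p\<in>Q. \<psi> p \<ge> 0"
  define \<phi> where "\<phi> = phi b c \<alpha>1 \<gamma>1 \<alpha>2 \<gamma>2"
  define G where "G = entropy_G \<phi> g K"
  define Gstar where
    "Gstar = (\<lambda>p. mix (lam p) (G (beta0 b c A B (v p))) (G (beta2 c \<alpha>2 \<gamma>2 (v p))))"
  define F where "F = (\<lambda>p. Gstar p * Dt \<psi> p - g (v p) * Dx v p * Dx \<psi> p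
                           - deriv g (v p) * \<bar>Dx v p\<bar>\<^sup>2 * \<psi> p)"

  \<comment> \<open>Support and regularity of the data\<close>
  have open_Q: "open Q" unfolding Q by (intro open_Times) auto
  define C where "C = closure {p. \<psi> p \<noteq> 0}"
  have C: "compact C" "C \<subseteq> Q" and \<psi>_Ck: "Ck_on (Suc 0) \<psi> Q"
    using \<psi> unfolding test_function_on_def C_def
    by (auto dest!: spec[of _ "Suc 0"] intro: continuous_on_subset)
  have \<psi>_0: "\<psi> p = 0" if "p \<in> Q - C" for p
    using that closure_subset[of "{p. \<psi> p \<noteq> 0}"] by (auto simp: C_def)

  have v1: "Ck_on (Suc (Suc 0)) v Q" using v_C2 by (simp add: numeral_2_eq_2)
  then have vx1: "Ck_on (Suc 0) (Dx v) Q" by simp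
  have lam1: "Ck_on (Suc 0) lam Q" using lam_C1 by simp
  note v_x = Ck_on_Suc_Dx_DERIV[OF v1] and v_t = Ck_on_Suc_Dt_DERIV[OF v1]
    and v_xx = Ck_on_Suc_Dx_DERIV[OF vx1] and lam_t_DERIV = Ck_on_Suc_Dt_DERIV[OF lam1]
    and \<psi>_x = Ck_on_Suc_Dx_DERIV[OF \<psi>_Ck] and \<psi>_t = Ck_on_Suc_Dt_DERIV[OF \<psi>_Ck]
  have cont_v: "continuous_on Q v" "continuous_on Q (Dx v)" "continuous_on Q (Dt v)"
      "continuous_on Q (Dx (Dx v))"
    and cont_lam: "continuous_on Q lam" "continuous_on Q (Dt lam)"
    and cont_\<psi>: "continuous_on Q \<psi>" "continuous_on Q (Dx \<psi>)" "continuous_on Q (Dt \<psi>)"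
    using v1 lam1 \<psi>_Ck by auto

  obtain g' where g': "\<And>s. (g has_real_derivative g' s) (at s)" "continuous_on UNIV g'"
    using g_C1 unfolding C1_differentiable_on_def
    by (auto simp: has_real_derivative_iff_has_vector_derivative)
  have g'_eq: "g' = deriv g" using DERIV_imp_deriv[OF g'(1)] by auto
  note g_DERIV = g'(1)[unfolded g'_eq]
  have cont_g': "continuous_on UNIV (deriv g)" using g'(2) unfolding g'_eq .
  have cont_g: "continuous_on UNIV g"
    by (intro continuous_at_imp_continuous_on ballI DERIV_isCont[OF g_DERIV])
  have mono_g: "mono g"
  proof (rule monoI)
    fix p q :: real assume "p \<le> q"
    then show "g p \<le> g q"
      by (rule DERIV_nonneg_imp_nondecreasing) (rule exI conjI g_DERIV g'_ge[rule_format])+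
  qed
  have cont_\<phi>: "continuous_on UNIV \<phi>" unfolding \<phi>_def by (rule continuous_on_phi) fact
  have G_DERIV: "(G has_real_derivative g (\<phi> w)) (at w)" for w
    unfolding G_def by (rule entropy_G_DERIV[OF cont_\<phi> cont_g])
  have cont_G: "continuous_on UNIV G"
    by (intro continuous_at_imp_continuous_on ballI DERIV_isCont[OF G_DERIV])

  \<comment> \<open>Affine extensions of the inverse branches\<close>
  define k0 where "k0 = - (c - b) / (B - A)"
  \<comment> \<open>Both extensions are differentiable on the whole line, hence also across the
    level \<open>B\<close>, beyond which \<open>beta0\<close> is unspecified; \<open>k0\<close> is
    the slope of \<open>e0\<close>.\<close>
  define e0 where "e0 = (\<lambda>w. b + (B - w) * (c - b) / (B - A))"
  define e2 where "e2 = (\<lambda>w. (w - \<gamma>2) / \<alpha>2)"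
  have e0_DERIV: "(e0 has_real_derivative k0) (at w)" for w
    unfolding e0_def k0_def
    by (rule DERIV_cong[OF DERIV_add[OF DERIV_const DERIV_cdivide[OF DERIV_cmult_right[OF
              DERIV_diff[OF DERIV_const DERIV_ident]]]]]) simp
  have e2_DERIV: "(e2 has_real_derivative 1 / \<alpha>2) (at w)" for w
    unfolding e2_def using \<open>\<alpha>2 > 0\<close> by (auto intro!: derivative_eq_intros)
  have cont_e: "continuous_on UNIV e0" "continuous_on UNIV e2"
    unfolding e0_def e2_def using \<open>A < B\<close> \<open>\<alpha>2 > 0\<close> by (auto intro!: continuous_intros)
  have e2: "beta2 c \<alpha>2 \<gamma>2 (v p) = e2 (v p)" if "p \<in> Q" for p
    using that v_ge A \<open>\<alpha>2 > 0\<close> by (simp add: e2_def beta2_eq)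
  have e0: "beta0 b c A B (v p) = e0 (v p)" if "p \<in> Q" "lam p \<noteq> 1" for p
    using that v_ge lam_one \<open>b < c\<close> \<open>A < B\<close> unfolding e0_def by (intro beta0_eq) force+
  \<comment> \<open>If \<open>lam p = 1\<close>, the factor \<open>1 - lam p\<close> removes any
    discrepancy between \<open>beta0\<close> and \<open>e0\<close>; otherwise
    \<open>v p \<le> B\<close> and they agree.\<close>
  have u_eq: "u p = (1 - lam p) * e0 (v p) + lam p * e2 (v p)" if "p \<in> Q" for p
    using e0[OF that] e2[OF that] by (cases "lam p = 1") (auto simp: u mix_def)
  have Gstar_eq: "Gstar p = (1 - lam p) * G (e0 (v p)) + lam p * G (e2 (v p))" if "p \<in> Q" for p
    using e0[OF that] e2[OF that] by (cases "lam p = 1") (auto simp: Gstar_def mix_def)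

  \<comment> \<open>Time derivatives of the entropy and of \<open>u\<close>\<close>
  define Gt where "Gt = (\<lambda>p. (1 - lam p) * (g (\<phi> (e0 (v p))) * (k0 * Dt v p))
      + lam p * (g (\<phi> (e2 (v p))) * (1 / \<alpha>2 * Dt v p))
      + Dt lam p * (G (e2 (v p)) - G (e0 (v p))))"
  have slice: "open {s. (x, s) \<in> Q}" for x by (rule open_slices(1)[OF open_Q])
  have Gstar_t: "((\<lambda>s. Gstar (x, s)) has_real_derivative Gt (x, t)) (at t)" if "(x, t) \<in> Q" for x t
  \<comment> \<open>\<open>Gstar_eq\<close> holds along the whole open slice, so the derivative may
    be computed from the formula with \<open>e0\<close> and \<open>e2\<close>.\<close>
  proof (rule has_field_derivative_transform_within_open[OF _ slice])
    show "((\<lambda>s. (1 - lam (x, s)) * G (e0 (v (x, s))) + lam (x, s) * G (e2 (v (x, s))))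
        has_real_derivative Gt (x, t)) (at t)"
      unfolding Gt_def
      by (rule derivative_eq_intros DERIV_chain2[OF G_DERIV] DERIV_chain2[OF e0_DERIV]
          DERIV_chain2[OF e2_DERIV] v_t[OF that] lam_t_DERIV[OF that] refl)+
        (simp add: algebra_simps)
  qed (use that in \<open>auto simp: Gstar_eq\<close>)
  \<comment> \<open>Uniqueness of derivatives equates the product-rule expression for the time
    derivative of \<open>u\<close> with the one supplied by the equation.\<close>
  have u_t: "(1 - lam (x, t)) * (k0 * Dt v (x, t)) + lam (x, t) * (1 / \<alpha>2 * Dt v (x, t))
      + Dt lam (x, t) * (e2 (v (x, t)) - e0 (v (x, t))) = Dx (Dx v) (x, t)" (is "?d = _")
    if "(x, t) \<in> Q" for x t
  proof (rule DERIV_unique)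
    show "((\<lambda>s. u (x, s)) has_real_derivative Dx (Dx v) (x, t)) (at t)" using pde that by auto
    show "((\<lambda>s. u (x, s)) has_real_derivative ?d) (at t)"
    proof (rule has_field_derivative_transform_within_open[OF _ slice])
      show "((\<lambda>s. (1 - lam (x, s)) * e0 (v (x, s)) + lam (x, s) * e2 (v (x, s)))
          has_real_derivative ?d) (at t)"
        by (rule derivative_eq_intros DERIV_chain2[OF e0_DERIV] DERIV_chain2[OF e2_DERIV]
            v_t[OF that] lam_t_DERIV[OF that] refl)+
          (simp add: algebra_simps)
    qed (use that in \<open>auto simp: u_eq\<close>)
  qed
  \<comment> \<open>where \<open>lam = 1\<close>, \<open>lam (x, \<sdot>)\<close> attains its maximum\<close>
  have lam_t_0: "Dt lam (x, t) = 0" if xt: "(x, t) \<in> Q" "lam (x, t) = 1" for x t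
  proof -
    obtain d where "d > 0" "ball t d \<subseteq> {s. (x, s) \<in> Q}"
      by (rule openE[OF slice[of x], of t]) (use xt in auto)
    then have "d > 0" "\<And>s. \<bar>t - s\<bar> < d \<Longrightarrow> (x, s) \<in> Q"
      by (auto simp: subset_iff dist_real_def)
    then show ?thesis
      using DERIV_local_max[OF lam_t_DERIV[OF xt(1)], of d] lam_range xt(2) by auto
  qed

  \<comment> \<open>Values of \<open>phi\<close> on the branches\<close>
  have \<phi>_e2: "\<phi> (e2 (v p)) = v p" if "p \<in> Q" for p
  proof -
    have "c \<le> e2 (v p)"
      using v_ge that A \<open>\<alpha>2 > 0\<close> by (auto simp: e2_def phi_outer_def field_simps)
    then show ?thesis
      using \<open>b < c\<close> \<open>\<alpha>2 > 0\<close> by (auto simp: \<phi>_def phi_def phi_outer_def e2_def)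
  qed
  have e0_ge: "b \<le> e0 w" if "w \<le> B" for w
    using that \<open>b < c\<close> \<open>A < B\<close> by (simp add: e0_def)
  have e0_le: "e0 w \<le> c" if "A \<le> w" for w
  proof -
    have "(B - w) * (c - b) \<le> (B - A) * (c - b)"
      using that \<open>b < c\<close> by (intro mult_right_mono) auto
    then show ?thesis using \<open>A < B\<close> by (simp add: e0_def field_simps)
  qed
  have \<phi>_e0: "\<phi> (e0 w) = w" if w: "A \<le> w" "w \<le> B" for w
  proof -
    have "phi_mid b c A B (e0 w) = w"
      using \<open>b < c\<close> \<open>A < B\<close> beta0_eq[of b c A B w]
      by (simp add: phi_mid_def e0_def divide_simps) (simp add: algebra_simps)
    moreover have "phi_mid b c A B b = B" "phi_mid b c A B c = A"
      using \<open>b < c\<close> by (auto simp: phi_mid_def field_simps)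
    \<comment> \<open>At the two endpoints \<open>phi\<close> is given by an outer branch, whose
      value there is that of \<open>phi_mid\<close>.\<close>
    moreover consider "e0 w = b" | "e0 w = c" | "b < e0 w" "e0 w < c"
      using e0_ge[OF w(2)] e0_le[OF w(1)] by fastforce
    then have "\<phi> (e0 w) = phi_mid b c A B (e0 w)"
      using \<open>b < c\<close> \<open>phi_mid b c A B b = B\<close> \<open>phi_mid b c A B c = A\<close>
      by cases (simp_all add: \<phi>_def phi_def A B)
    ultimately show ?thesis by simp
  qed

  \<comment> \<open>The pointwise entropy inequality\<close>
  have Gt_le: "Gt p \<le> g (v p) * Dx (Dx v) p" if pQ: "p \<in> Q" for p
  proof (cases p)
    case (Pair x t)
    have xt: "(x, t) \<in> Q" using that Pair by simp
    show ?thesis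
    proof (cases "lam p = 1")
      \<comment> \<open>Here \<open>v p\<close> may exceed \<open>B\<close>, but both terms with
        \<open>e0\<close> drop out: one carries \<open>1 - lam p\<close>, the other
        \<open>Dt lam p\<close>, which is 0. Equality holds.\<close>
      case True
      then show ?thesis
        using u_t[OF xt] lam_t_0[OF xt] \<phi>_e2[OF pQ] by (simp add: Gt_def Pair flip: times_divide_eq_right)
    next
      case False
      \<comment> \<open>Now \<open>v p\<close> lies between \<open>A\<close> and \<open>B\<close>,
        so \<open>e0\<close> and \<open>e2\<close> are genuine inverses there, with
        \<open>e0 (v p) \<le> c \<le> e2 (v p)\<close>.\<close>
      then have w: "A \<le> v p" "v p \<le> B" using v_ge lam_one pQ by force+
      have "c \<le> e2 (v p)"
        using w A \<open>\<alpha>2 > 0\<close> by (auto simp: e2_def phi_outer_def field_simps)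
      then have "G (e2 (v p)) - G (e0 (v p)) \<le> g (v p) * (e2 (v p) - e0 (v p))"
        unfolding G_def
        using e0_le[OF w(1)] phi_le_between_branches[OF \<open>b < c\<close> \<open>\<alpha>2 > 0\<close> A B \<open>A < B\<close> w]
        by (intro entropy_G_increment_le cont_\<phi> cont_g mono_g) (auto simp: e0_def e2_def \<phi>_def)
      \<comment> \<open>Monotonicity of \<open>lam\<close> in time preserves the direction of the
        inequality.\<close>
      then have "Dt lam p * (G (e2 (v p)) - G (e0 (v p)))
          \<le> Dt lam p * (g (v p) * (e2 (v p) - e0 (v p)))"
        using lam_t pQ by (intro mult_left_mono) auto
      moreover have "g (v p) * Dx (Dx v) p = g (v p) * ((1 - lam p) * (k0 * Dt v p)
          + lam p * (1 / \<alpha>2 * Dt v p) + Dt lam p * (e2 (v p) - e0 (v p)))"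
        using u_t[OF xt] Pair by simp
      ultimately show ?thesis
        unfolding Gt_def \<phi>_e2[OF pQ] \<phi>_e0[OF w] by (simp add: algebra_simps)
    qed
  qed

  \<comment> \<open>Continuity of the integrands\<close>
  have cont_gv: "continuous_on Q (\<lambda>p. g (v p))" "continuous_on Q (\<lambda>p. deriv g (v p))"
    using continuous_on_compose2[OF cont_g cont_v(1)] continuous_on_compose2[OF cont_g' cont_v(1)]
    by auto
  have cont_Gv: "continuous_on Q (\<lambda>p. G (e0 (v p)))" "continuous_on Q (\<lambda>p. G (e2 (v p)))"
    and cont_g\<phi>v: "continuous_on Q (\<lambda>p. g (\<phi> (e0 (v p))))" "continuous_on Q (\<lambda>p. g (\<phi> (e2 (v p))))"
    by (auto intro!: continuous_on_compose2[OF cont_G] continuous_on_compose2[OF cont_e(1)]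
        continuous_on_compose2[OF cont_e(2)] continuous_on_compose2[OF cont_g]
        continuous_on_compose2[OF cont_\<phi>] cont_v)
  have cont_Gstar: "continuous_on Q Gstar"
    by (rule continuous_on_eq[of _ "\<lambda>p. (1 - lam p) * G (e0 (v p)) + lam p * G (e2 (v p))"])
      (auto simp: Gstar_eq intro!: continuous_intros cont_lam cont_Gv)
  have cont_Gt: "continuous_on Q Gt"
    unfolding Gt_def by (intro continuous_intros cont_lam cont_Gv cont_g\<phi>v cont_v)

  \<comment> \<open>Integration over \<open>Q\<close>\<close>
  define I1 where "I1 = (\<lambda>p. Gt p * \<psi> p + Gstar p * Dt \<psi> p)"
  \<comment> \<open>\<open>I1\<close> is the \<open>t\<close>-derivative of
    \<open>Gstar p * \<psi> p\<close>, and \<open>I2\<close> the \<open>x\<close>-derivative of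
    \<open>g (v p) * Dx v p * \<psi> p\<close>; the latter produces the quadratic gradient term.
    \<open>I3\<close> carries the sign.\<close>
  define I2 where "I2 = (\<lambda>p. (deriv g (v p) * Dx v p * Dx v p + g (v p) * Dx (Dx v) p) * \<psi> p
      + g (v p) * Dx v p * Dx \<psi> p)"
  define I3 where "I3 = (\<lambda>p. \<psi> p * (g (v p) * Dx (Dx v) p - Gt p))"
  have I1: "set_integrable lborel Q I1" "set_lebesgue_integral lborel Q I1 = 0"
  proof -
    have der: "((\<lambda>s. Gstar (x, s) * \<psi> (x, s)) has_real_derivative I1 (x, t)) (at t)"
      if "(x, t) \<in> Q" for x t
      unfolding I1_def
      by (rule derivative_eq_intros Gstar_t[OF that] \<psi>_t[OF that] refl)+ (simp add: algebra_simps)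
    have "continuous_on Q I1"
      unfolding I1_def by (intro continuous_intros cont_Gt cont_Gstar cont_\<psi>)
    note * = set_integral_t_derivative_eq_0[OF open_Q C, of "\<lambda>p. Gstar p * \<psi> p", OF _ der this]
    show "set_integrable lborel Q I1" "set_lebesgue_integral lborel Q I1 = 0"
      using \<psi>_0 by (auto intro!: *)
  qed
  have I2: "set_integrable lborel Q I2" "set_lebesgue_integral lborel Q I2 = 0"
  proof -
    have der: "((\<lambda>y. g (v (y, t)) * Dx v (y, t) * \<psi> (y, t)) has_real_derivative I2 (x, t)) (at x)"
      if "(x, t) \<in> Q" for x t
      unfolding I2_def
      by (rule derivative_eq_intros DERIV_chain2[OF g_DERIV] v_x[OF that] v_xx[OF that]
          \<psi>_x[OF that] refl)+ (simp add: algebra_simps)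
    have "continuous_on Q I2"
      unfolding I2_def by (intro continuous_intros cont_gv cont_v cont_\<psi>)
    note * = set_integral_x_derivative_eq_0[OF open_Q C, of "\<lambda>p. g (v p) * Dx v p * \<psi> p",
        OF _ der this]
    show "set_integrable lborel Q I2" "set_lebesgue_integral lborel Q I2 = 0"
      using \<psi>_0 by (auto intro!: *)
  qed
  have I3: "set_integrable lborel Q I3"
    by (rule set_integrable_compact_support[OF C])
      (auto simp: I3_def \<psi>_0 intro!: continuous_intros cont_gv cont_v cont_\<psi> cont_Gt)
  have I3_ge: "set_lebesgue_integral lborel Q I3 \<ge> 0"
    unfolding set_lebesgue_integral_def I3_def using Gt_le \<psi>_ge
    by (intro Bochner_Integration.integral_nonneg) (auto simp: indicator_def)
  \<comment> \<open>The terms with \<open>Gt\<close> and with \<open>Dx (Dx v)\<close> cancel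
    algebraically at every point.\<close>
  have F_eq: "F = (\<lambda>p. (I1 p - I2 p) + I3 p)"
    by (auto simp: F_def I1_def I2_def I3_def algebra_simps power2_eq_square abs_mult_self_eq)
  have I12: "set_integrable lborel Q (\<lambda>p. I1 p - I2 p)"
    by (rule set_integral_diff(1)[OF I1(1) I2(1)])
  have "set_integrable lborel Q F"
    unfolding F_eq by (rule set_integral_add(1)[OF I12 I3])
  moreover have "set_lebesgue_integral lborel Q F = set_lebesgue_integral lborel Q I3"
    unfolding F_eq set_integral_add(2)[OF I12 I3] set_integral_diff(2)[OF I1(1) I2(1)]
    using I1(2) I2(2) by simp
  ultimately have "set_integrable lborel Q F \<and> set_lebesgue_integral lborel Q F \<ge> 0"
    using I3_ge by simp
  then show "let G = entropy_G (phi b c \<alpha>1 \<gamma>1 \<alpha>2 \<gamma>2) g K;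
                Gstar = (\<lambda>p. mix (lam p) (G (beta0 b c A B (v p))) (G (beta2 c \<alpha>2 \<gamma>2 (v p))));
                F = (\<lambda>p. Gstar p * Dt \<psi> p - g (v p) * Dx v p * Dx \<psi> p
                           - deriv g (v p) * \<bar>Dx v p\<bar>\<^sup>2 * \<psi> p)
            in set_integrable lborel Q F \<and> set_lebesgue_integral lborel Q F \<ge> 0"
    unfolding Let_def F_def Gstar_def G_def \<phi>_def .
qed

end
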